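(* Let $L$ be a finite-dimensional upper semi-modular solvable Leibniz algebra over an arbitrary field $F$, and let $J=\langle x\in L\mid x^2=0\rangle$ be the subalgebra of $L$ generated by all elements with square zero. Then $J$ is abelian or almost abelian.
   Context: A (right) Leibniz algebra over a field $F$ is a vector space $L$ with a bilinear product $[\cdot,\cdot]$ satisfying $[x,[y,z]]=[[x,y],z]-[[x,z],y]$ for all $x,y,z$. Write $x^2=[x,x]$. $L$ is solvable if $L^{(n)}=0$ for some $n$, where $L^{(0)}=L$, $L^{(k+1)}=[L^{(k)},L^{(k)}]$. A Leibniz algebra is abelian if all its products are zero. For subalgebras (or elements) $U,B$, $\langle U,B\rangle$ denotes the subalgebra they generate. A subalgebra $U$ of $L$ is upper semi-modular in $L$ if $U$ is a maximal subalgebra of $\langle U,B\rangle$ for every subalgebra $B$ of $L$ such that $U\cap B$ is a maximal subalgebra of $B$ (a maximal subalgebra is a maximal proper subalgebra). $L$ is upper semi-modular if every subalgebra of $L$ is upper semi-modular in $L$. A Leibniz algebra $M$ is almost abelian if $M=A+Fy$ where $A\neq 0$ is an abelian ideal, $[a,y]=a$ for all $a\in A$, and either $[y,a]=-a$ for all $a\in A$ (almost abelian Lie algebra; here $M$ is a Lie algebra), or $[y,a]=0$ for all $a\in A$ (almost abelian non-Lie Leibniz algebra); $y$ may be taken with $y^2=0$. *)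

theory Defs
  imports Complex_Main
begin

locale leibniz_algebra = vector_space scale
  for scale :: "'f::field \<Rightarrow> 'v::ab_group_add \<Rightarrow> 'v" (infixr \<open>*s\<close> 75) +
  fixes br :: "'v \<Rightarrow> 'v \<Rightarrow> 'v"  (infixl \<open>\<bullet>\<close> 70)
  assumes linear_left: "Vector_Spaces.linear scale scale (\<lambda>x. x \<bullet> y)"
    and linear_right: "Vector_Spaces.linear scale scale (\<lambda>y. x \<bullet> y)"
    and leibniz: "x \<bullet> (y \<bullet> z) = (x \<bullet> y) \<bullet> z - (x \<bullet> z) \<bullet> y"
begin

text \<open>The algebra itself is the whole type \<^typ>\<open>'v\<close>; its subalgebras are subsets.\<close>

definition finite_dim :: bool where
  "finite_dim \<longleftrightarrow> (\<exists>B. finite B \<and> span B = UNIV)"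

definition subalgebra :: "'v set \<Rightarrow> bool" where
  "subalgebra U \<longleftrightarrow> subspace U \<and> (\<forall>x\<in>U. \<forall>y\<in>U. x \<bullet> y \<in> U)"

definition generated :: "'v set \<Rightarrow> 'v set" where
  "generated S = subalgebra hull S"

definition maximal_subalgebra :: "'v set \<Rightarrow> 'v set \<Rightarrow> bool" where
  "maximal_subalgebra M B \<longleftrightarrow> subalgebra M \<and> subalgebra B \<and> M \<subset> B \<and>
     (\<forall>C. subalgebra C \<longrightarrow> M \<subseteq> C \<longrightarrow> C \<subseteq> B \<longrightarrow> C = M \<or> C = B)"

definition upper_semimodular_in :: "'v set \<Rightarrow> bool" where
  "upper_semimodular_in U \<longleftrightarrow> subalgebra U \<and>
     (\<forall>B. subalgebra B \<longrightarrow> maximal_subalgebra (U \<inter> B) B \<longrightarrow>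
          maximal_subalgebra U (generated (U \<union> B)))"

definition upper_semimodular :: bool where
  "upper_semimodular \<longleftrightarrow> (\<forall>U. subalgebra U \<longrightarrow> upper_semimodular_in U)"

text \<open>As usual, the product of two subspaces is the linear span of the products of their elements.\<close>

primrec derived :: "nat \<Rightarrow> 'v set" where
  "derived 0 = UNIV"
| "derived (Suc k) = span {x \<bullet> y | x y. x \<in> derived k \<and> y \<in> derived k}"

definition solvable :: bool where
  "solvable \<longleftrightarrow> (\<exists>n. derived n = {0})"

definition abelian :: "'v set \<Rightarrow> bool" where
  "abelian U \<longleftrightarrow> subalgebra U \<and> (\<forall>x\<in>U. \<forall>y\<in>U. x \<bullet> y = 0)"

definition ideal_of :: "'v set \<Rightarrow> 'v set \<Rightarrow> bool" where
  "ideal_of A M \<longleftrightarrow> subspace A \<and> A \<subseteq> M \<and>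
     (\<forall>a\<in>A. \<forall>m\<in>M. a \<bullet> m \<in> A \<and> m \<bullet> a \<in> A)"

definition almost_abelian_split :: "'v set \<Rightarrow> 'v set \<Rightarrow> 'v \<Rightarrow> bool" where
  "almost_abelian_split M A y \<longleftrightarrow> subalgebra M \<and> A \<noteq> {0} \<and> abelian A \<and> ideal_of A M \<and>
     M = {a + c *s y | a c. a \<in> A} \<and> (\<forall>a\<in>A. a \<bullet> y = a)"

definition almost_abelian_Lie :: "'v set \<Rightarrow> bool" where
  "almost_abelian_Lie M \<longleftrightarrow>
     (\<exists>A y. almost_abelian_split M A y \<and> (\<forall>a\<in>A. y \<bullet> a = - a))"

definition almost_abelian_nonLie :: "'v set \<Rightarrow> bool" where
  "almost_abelian_nonLie M \<longleftrightarrow>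
     (\<exists>A y. almost_abelian_split M A y \<and> (\<forall>a\<in>A. y \<bullet> a = 0))"

definition almost_abelian :: "'v set \<Rightarrow> bool" where
  "almost_abelian M \<longleftrightarrow> almost_abelian_Lie M \<or> almost_abelian_nonLie M"

text \<open>
  The definitions above do not ask for \<open>y\<close> to have square zero, nor for \<open>M\<close> to be a Lie algebra
  in the first case. The next lemmas show that the latter is automatic and that \<open>y\<close> can be so chosen.
\<close>

lemma br_simps:
  "((x + x') \<bullet> y) = (x \<bullet> y) + (x' \<bullet> y)"
  "(x \<bullet> (y + y')) = (x \<bullet> y) + (x \<bullet> y')"
  "((x - x') \<bullet> y) = (x \<bullet> y) - (x' \<bullet> y)"
  "(x \<bullet> (y - y')) = (x \<bullet> y) - (x \<bullet> y')"
  "((c *s x) \<bullet> y) = c *s (x \<bullet> y)"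
  "(x \<bullet> (c *s y)) = c *s (x \<bullet> y)"
proof -
  interpret l: Vector_Spaces.linear scale scale "\<lambda>x. x \<bullet> y" for y by (rule linear_left)
  interpret r: Vector_Spaces.linear scale scale "\<lambda>y. x \<bullet> y" for x by (rule linear_right)
  show "((x + x') \<bullet> y) = (x \<bullet> y) + (x' \<bullet> y)" by (rule l.add)
  show "(x \<bullet> (y + y')) = (x \<bullet> y) + (x \<bullet> y')" by (rule r.add)
  show "((x - x') \<bullet> y) = (x \<bullet> y) - (x' \<bullet> y)" by (rule l.diff)
  show "(x \<bullet> (y - y')) = (x \<bullet> y) - (x \<bullet> y')" by (rule r.diff)
  show "((c *s x) \<bullet> y) = c *s (x \<bullet> y)" by (rule l.scale)
  show "(x \<bullet> (c *s y)) = c *s (x \<bullet> y)" by (rule r.scale)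
qed

lemma br_square: "(x \<bullet> (y \<bullet> y)) = 0"
  using leibniz[of x y y] by simp

lemma split_square_mem:
  assumes "almost_abelian_split M A y"
  shows "y \<bullet> y \<in> A"
proof -
  have M: "M = {a + c *s y | a c. a \<in> A}" and sub: "subalgebra M"
    and A: "A \<noteq> {0}" "abelian A" "subspace A" and ay: "\<And>a. a \<in> A \<Longrightarrow> a \<bullet> y = a"
    using assms by (auto simp: almost_abelian_split_def ideal_of_def)
  have "y \<in> M"
    unfolding M using subspace_0[OF A(3)] by (auto intro!: exI[of _ 0] exI[of _ 1])
  then have "y \<bullet> y \<in> M" using sub by (auto simp: subalgebra_def)
  then obtain a' c where e: "y \<bullet> y = a' + c *s y" "a' \<in> A" unfolding M by auto
  obtain a where a: "a \<in> A" "a \<noteq> 0" using A(1) subspace_0[OF A(3)] by auto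
  have "c *s a = (a \<bullet> (y \<bullet> y))"
    using a e A(2) ay by (simp add: br_simps abelian_def)
  then have "c = 0" using a by (simp add: br_square)
  then show ?thesis using e by simp
qed

lemma almost_abelian_Lie_square_zero:
  assumes s: "almost_abelian_split M A y" and ya: "\<forall>a\<in>A. y \<bullet> a = - a"
    and x: "x \<in> M"
  shows "x \<bullet> x = 0"
proof -
  have "- (y \<bullet> y) = (y \<bullet> (y \<bullet> y))" using ya split_square_mem[OF s] by simp
  then have yy: "y \<bullet> y = 0" by (simp add: br_square)
  obtain a c where "x = a + c *s y" "a \<in> A"
    using s x by (auto simp: almost_abelian_split_def)
  then show ?thesis using s ya yy
    by (simp add: br_simps almost_abelian_split_def abelian_def)
qed

lemma almost_abelian_nonLie_normal_form:
  assumes s: "almost_abelian_split M A y" and ya: "\<forall>a\<in>A. y \<bullet> a = 0"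
  shows "\<exists>z. almost_abelian_split M A z \<and> (\<forall>a\<in>A. z \<bullet> a = 0) \<and> z \<bullet> z = 0"
proof (intro exI conjI)
  let ?b = "y \<bullet> y" and ?z = "y - (y \<bullet> y)"
  have b: "?b \<in> A" by (rule split_square_mem[OF s])
  have A: "abelian A" "subspace A" "M = {a + c *s y | a c. a \<in> A}"
    and ay: "\<And>a. a \<in> A \<Longrightarrow> a \<bullet> y = a"
    using s by (auto simp: almost_abelian_split_def ideal_of_def)
  have "a + c *s y = (a + c *s ?b) + c *s ?z" "a + c *s ?z = (a - c *s ?b) + c *s y" for a c
    by (simp_all add: scale_right_diff_distrib)
  moreover have "a + c *s ?b \<in> A" "a - c *s ?b \<in> A" if "a \<in> A" for a c
    using that b A(2) by (auto intro: subspace_add subspace_diff subspace_scale)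
  ultimately have "{a + c *s y | a c. a \<in> A} = {a + c *s ?z | a c. a \<in> A}"
    by blast
  with A(3) have "M = {a + c *s ?z | a c. a \<in> A}" by (rule trans)
  moreover have "\<forall>a\<in>A. a \<bullet> ?z = a" using ay by (simp add: br_simps br_square)
  ultimately show "almost_abelian_split M A ?z"
    using s unfolding almost_abelian_split_def by blast
  show "\<forall>a\<in>A. (?z \<bullet> a) = 0" using ya A(1) b by (simp add: br_simps abelian_def)
  show "(?z \<bullet> ?z) = 0" using ay[OF b] by (simp add: br_simps br_square)
qed

end

end

theory Submission
  imports Defs
begin

text \<open>
  Semi-modularity is only needed for lines spanned by elements of square zero: if \<open>x\<close> and \<open>y\<close> are
  two independent such elements, both lines are maximal in \<open>T = \<langle>x, y\<rangle>\<close>. A nonzero abelian ideal of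
  \<open>T\<close>, which exists by solvability, consists of elements of square zero too, and this forces \<open>T\<close> to
  be two-dimensional. So the square-zero elements span \<open>J\<close>, and any two of them span a subalgebra.

  If square-zero elements always anticommute, then \<open>J\<close> is a Lie algebra in which any two elements
  span a subalgebra, hence abelian or almost abelian. Otherwise some pair satisfies \<open>[z, y] = z\<close>
  and \<open>[y, z] = 0\<close>, so that \<open>z = (z + y)\<^sup>2\<close>; comparing the square-zero elements \<open>w\<close> and \<open>w + z\<close>
  for \<open>[z, w] = 0\<close> shows that all such \<open>w\<close> behave like \<open>z\<close>, and these together with \<open>y\<close> span \<open>J\<close>.
\<close>

context leibniz_algebra
begin

section \<open>Bilinearity, lines and generated subalgebras\<close>

lemma br_zero [simp]: "(0 \<bullet> y) = 0" "(x \<bullet> 0) = 0"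
  using br_simps(3)[of 0 0 y] br_simps(4)[of x 0 0] by auto

lemma br_minus: "((- x) \<bullet> y) = - (x \<bullet> y)" "(x \<bullet> (- y)) = - (x \<bullet> y)"
  using br_simps(3)[of 0 x y] br_simps(4)[of x 0 y] by auto

lemma span_pair: "v \<in> span {x, y} \<longleftrightarrow> (\<exists>a b. v = a *s x + b *s y)"
  by (auto simp: span_insert span_singleton algebra_simps)

lemma scale_mem_subspace_cancel:
  assumes "subspace U" "c *s x \<in> U" "c \<noteq> 0"
  shows "x \<in> U"
  using subspace_scale[OF assms(1,2), of "inverse c"] assms(3) by simp

lemma subalgebra_zero: "subalgebra {0}"
  by (simp add: subalgebra_def)

lemma subalgebra_span_singleton: "(x \<bullet> x) = 0 \<Longrightarrow> subalgebra (span {x})"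
  unfolding subalgebra_def by (intro conjI subspace_span) (auto simp: span_singleton br_simps)

lemma subalgebra_Inter: "(\<And>U. U \<in> \<U> \<Longrightarrow> subalgebra U) \<Longrightarrow> subalgebra (\<Inter>\<U>)"
  by (auto simp: subalgebra_def intro!: subspace_Inter)

lemma subalgebra_generated: "subalgebra (generated S)"
  unfolding generated_def hull_def by (rule subalgebra_Inter) auto

lemma generated_superset: "S \<subseteq> generated S"
  unfolding generated_def by (rule hull_subset)

lemma generated_minimal: "S \<subseteq> U \<Longrightarrow> subalgebra U \<Longrightarrow> generated S \<subseteq> U"
  unfolding generated_def by (rule hull_minimal)

section \<open>Semi-modularity for lines of square zero\<close>

text \<open>The lines of \<open>x\<close> and \<open>y\<close> meet in zero, and zero is maximal in
  a line. Upper semi-modularity of \<open>span {x}\<close> therefore makes it maximal in the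
  subalgebra generated by \<open>x\<close> and \<open>y\<close>. This is the only form in which
  semi-modularity is applied.\<close>

lemma line_maximal:
  assumes usm: "upper_semimodular"
    and x: "(x \<bullet> x) = 0" and y: "(y \<bullet> y) = 0" and y_notin: "y \<notin> span {x}"
    and C: "subalgebra C" "x \<in> C" "C \<subseteq> generated {x, y}"
  shows "C = span {x} \<or> y \<in> C"
proof -
  have sx: "subalgebra (span {x})" and sy: "subalgebra (span {y})"
    using x y by (auto intro: subalgebra_span_singleton)
  have int: "span {x} \<inter> span {y} = {0}"
  proof (intro equalityI subsetI)
    fix v assume v: "v \<in> span {x} \<inter> span {y}"
    then obtain c where "v = c *s y" by (auto simp: span_singleton)
    then show "v \<in> {0}"
      using v y_notin scale_mem_subspace_cancel[OF subspace_span, of c y "{x}"] by auto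
  qed (simp add: span_zero)
  have "y \<noteq> 0" using y_notin span_zero by auto
  have "maximal_subalgebra {0} (span {y})"
    unfolding maximal_subalgebra_def
  proof (intro conjI allI impI subalgebra_zero sy)
    show "{0} \<subset> span {y}" using \<open>y \<noteq> 0\<close> span_zero span_base[of y "{y}"] by auto
    fix D assume D: "subalgebra D" "{0} \<subseteq> D" "D \<subseteq> span {y}"
    show "D = {0} \<or> D = span {y}"
    proof (cases "D = {0}")
      case False
      then obtain d where d: "d \<in> D" "d \<noteq> 0" using D by auto
      then obtain c where "d = c *s y" using D by (auto simp: span_singleton)
      then have "y \<in> D"
        using d D scale_mem_subspace_cancel[of D c y] by (auto simp: subalgebra_def)
      then have "span {y} \<subseteq> D" using D by (intro span_minimal) (auto simp: subalgebra_def)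
      then show ?thesis using D by auto
    qed simp
  qed
  then have max: "maximal_subalgebra (span {x}) (generated (span {x} \<union> span {y}))"
    using usm sx sy int unfolding upper_semimodular_def upper_semimodular_in_def by metis
  have "generated {x, y} \<subseteq> generated (span {x} \<union> span {y})"
    using generated_superset[of "span {x} \<union> span {y}"] span_base
    by (intro generated_minimal subalgebra_generated) (auto simp: subset_iff)
  then have "C \<subseteq> generated (span {x} \<union> span {y})" using C by auto
  moreover have "span {x} \<subseteq> C" using C by (intro span_minimal) (auto simp: subalgebra_def)
  ultimately have "C = span {x} \<or> C = generated (span {x} \<union> span {y})"
    using max C(1) unfolding maximal_subalgebra_def by blast
  then show ?thesis
    using generated_superset[of "span {x} \<union> span {y}"] span_base[of y "{y}"] by auto
qed

section \<open>Solvability and abelian ideals\<close>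

lemma subspace_derived: "subspace (derived k)"
  by (cases k) auto

text \<open>The Leibniz identity rewrites a product of \<open>m\<close> with
  \<open>x \<bullet> y\<close>, on either side, as a combination of two products of elements of
  \<open>derived k\<close>, once \<open>derived k\<close> is known to be an ideal.\<close>

lemma derived_ideal: "ideal_of (derived k) UNIV"
proof (induction k)
  case (Suc k)
  let ?D = "derived k" and ?E = "derived (Suc k)"
  have prod: "x \<bullet> y \<in> ?E" if "x \<in> ?D" "y \<in> ?D" for x y
    using that by (auto intro: span_base)
  have "a \<bullet> m \<in> ?E \<and> m \<bullet> a \<in> ?E" if "a \<in> ?E" for a m
    using that[unfolded derived.simps]
  proof (induction rule: span_induct)
    case base
    show ?case
      by (auto simp: subspace_def br_simps simp del: derived.simps
          intro!: subspace_add[OF subspace_derived] subspace_scale[OF subspace_derived]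
            subspace_0[OF subspace_derived])
  next
    case (step a)
    then obtain x y where a: "a = x \<bullet> y" "x \<in> ?D" "y \<in> ?D" by auto
    have "(x \<bullet> y) \<bullet> m = (x \<bullet> (y \<bullet> m)) + ((x \<bullet> m) \<bullet> y)" by (simp add: leibniz)
    moreover have "m \<bullet> (x \<bullet> y) = ((m \<bullet> x) \<bullet> y) - ((m \<bullet> y) \<bullet> x)" by (rule leibniz)
    ultimately show ?case
      using Suc a prod subspace_add[OF subspace_derived, of _ "Suc k"]
        subspace_diff[OF subspace_derived, of _ "Suc k"]
      unfolding ideal_of_def by (metis UNIV_I)
  qed
  then show ?case unfolding ideal_of_def using subspace_derived by blast
qed (auto simp: ideal_of_def)

text \<open>The ideal is \<open>T \<inter> derived k\<close> for a \<open>k\<close> at which it is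
  nonzero while the next intersection vanishes: products of its elements fall into the latter.
  Intersecting with the derived series of the whole algebra avoids a separate series for
  \<open>T\<close>.\<close>

lemma solvable_abelian_ideal:
  assumes "solvable" "subalgebra T" "T \<noteq> {0}"
  obtains A where "A \<noteq> {0}" "ideal_of A T" "abelian A"
proof -
  define P where "P k \<longleftrightarrow> T \<inter> derived k = {0}" for k
  have T: "subspace T" using assms(2) by (simp add: subalgebra_def)
  obtain n where "P n" using assms(1) subspace_0[OF T] unfolding solvable_def P_def by auto
  moreover have "\<not> P 0" using assms(3) by (simp add: P_def)
  ultimately obtain k where k: "\<not> P k" "P (Suc k)"
    using ex_least_nat_less[of P n] by auto
  let ?A = "T \<inter> derived k"
  have id: "ideal_of ?A T"
    using derived_ideal[of k] assms(2)
    by (auto simp: ideal_of_def subalgebra_def subspace_inter)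
  have "x \<bullet> y = 0" if "x \<in> ?A" "y \<in> ?A" for x y
  proof -
    have "x \<bullet> y \<in> derived (Suc k)" using that by (auto intro: span_base)
    then show ?thesis using that assms(2) k(2) unfolding subalgebra_def P_def by blast
  qed
  then have "abelian ?A" using id unfolding abelian_def subalgebra_def ideal_of_def by blast
  then show thesis using that[of ?A] id k(1) by (simp add: P_def)
qed

section \<open>Pairs of elements of square zero\<close>

text \<open>An abelian ideal \<open>A\<close> of the generated subalgebra \<open>T\<close> is
  compared with \<open>span {x}\<close>. Either \<open>A\<close> lies in that line, or maximality of
  lines leaves only two options: \<open>A\<close> is another line, or \<open>A\<close> contains both
  \<open>x\<close> and \<open>y\<close>.\<close>

lemma square_zero_pair_closed:
  assumes sol: "solvable" and usm: "upper_semimodular"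
    and x: "(x \<bullet> x) = 0" and y: "(y \<bullet> y) = 0"
  shows "x \<bullet> y \<in> span {x, y}"
proof (cases "x = 0 \<or> y \<in> span {x}")
  case True
  then have "x \<bullet> y = 0" using x by (auto simp: span_singleton br_simps)
  then show ?thesis by (simp add: span_zero)
next
  case False
  then have x0: "x \<noteq> 0" and yx: "y \<notin> span {x}" by auto
  define T where "T = generated {x, y}"
  have T: "subalgebra T" "x \<in> T" "y \<in> T" "subspace T"
    using subalgebra_generated[of "{x,y}"] generated_superset[of "{x,y}"]
    by (auto simp: T_def subalgebra_def)
  have max: "y \<in> C" if "subalgebra C" "x \<in> C" "C \<subseteq> T" "C \<noteq> span {x}" for C
    using line_maximal[OF usm x y yx] that by (auto simp: T_def)
  obtain A where A: "A \<noteq> {0}" "ideal_of A T" "abelian A"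
    using solvable_abelian_ideal[OF sol T(1)] T(2) x0 by blast
  have sA: "subalgebra A" "subspace A" "A \<subseteq> T" and zA: "\<And>u v. u \<in> A \<Longrightarrow> v \<in> A \<Longrightarrow> u \<bullet> v = 0"
    and iA: "\<And>u v. u \<in> A \<Longrightarrow> v \<in> T \<Longrightarrow> u \<bullet> v \<in> A \<and> v \<bullet> u \<in> A"
    using A by (auto simp: ideal_of_def abelian_def)
  show ?thesis
  proof (cases "A \<subseteq> span {x}")
    case True
    obtain a where a: "a \<in> A" "a \<noteq> 0" using A(1) subspace_0[OF sA(2)] by auto
    then obtain c where "a = c *s x" using True by (auto simp: span_singleton)
    then have "x \<in> A" using a scale_mem_subspace_cancel[OF sA(2), of c x] by auto
    then have "x \<bullet> y \<in> span {x}" using iA T True by blast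
    then show ?thesis using span_mono[of "{x}" "{x,y}"] by auto
  next
    case False
    then obtain a where a: "a \<in> A" "a \<notin> span {x}" by auto
    have xa: "x \<notin> span {a}"
      using a(2) x0 in_span_insert[of x a "{}"] by auto
    \<comment> \<open>Maximality of \<open>span {x}\<close> puts \<open>y\<close> into
      \<open>generated {a, x}\<close>, which is therefore large enough to contain \<open>A\<close>.
      Now \<open>line_maximal\<close> applies a second time, to the line of \<open>a\<close>, with
      \<open>x\<close> as second generator and \<open>A\<close> as intermediate subalgebra.\<close>
    have "y \<in> generated {a, x}"
      using generated_superset[of "{a,x}"] a T sA
      by (intro max subalgebra_generated generated_minimal) auto
    then have "A \<subseteq> generated {a, x}"
      using generated_minimal[OF _ subalgebra_generated, of "{x,y}" "{a,x}"]
        generated_superset[of "{a,x}"] sA by (auto simp: T_def)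
    then consider "A = span {a}" | "x \<in> A"
      using line_maximal[OF usm _ x xa sA(1) a(1)] zA a by blast
    then show ?thesis
    proof cases
      case 1
      have xa_mem: "x \<bullet> a \<in> span {a}" and ax_mem: "a \<bullet> x \<in> span {a}"
        using iA a T 1 by auto
      have le: "span {a} \<subseteq> span {a, x}" by (intro span_mono) auto
      have sub: "subalgebra (span {a, x})"
        unfolding subalgebra_def
      proof (intro conjI ballI subspace_span)
        fix u v assume "u \<in> span {a, x}" "v \<in> span {a, x}"
        then obtain p q r s where "u = p *s a + q *s x" "v = r *s a + s *s x"
          by (auto simp: span_pair)
        then have "u \<bullet> v = (q * r) *s (x \<bullet> a) + (p * s) *s (a \<bullet> x)"
          using zA[OF a(1) a(1)] x by (simp add: br_simps scale_right_distrib algebra_simps)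
        then have "u \<bullet> v \<in> span {a}"
          using xa_mem ax_mem by (simp add: span_add span_scale)
        then show "u \<bullet> v \<in> span {a, x}" using le by auto
      qed
      \<comment> \<open>This subalgebra is larger than the line of \<open>x\<close>, so it contains
        \<open>y\<close>; the exchange property then brings \<open>a\<close> back into
        \<open>span {x, y}\<close>.\<close>
      have "y \<in> span {a, x}"
      proof (rule max[OF sub])
        show "span {a, x} \<subseteq> T" using a sA T by (intro span_minimal) auto
        show "span {a, x} \<noteq> span {x}" using a span_base[of a "{a,x}"] by auto
      qed (auto intro: span_base)
      then have "a \<in> span {y, x}" using yx by (rule in_span_insert)
      then have "span {a} \<subseteq> span {x, y}"
        by (intro span_minimal) (auto simp: insert_commute)
      moreover obtain p q where "y = p *s a + q *s x"
        using \<open>y \<in> span {a, x}\<close> by (auto simp: span_pair)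
      then have "x \<bullet> y = p *s (x \<bullet> a)" using x by (simp add: br_simps)
      then have "x \<bullet> y \<in> span {a}" using xa_mem by (simp add: span_scale)
      ultimately show ?thesis by auto
    next
      case 2
      then have "y \<in> A" using max[OF sA(1) _ sA(3)] a span_base by blast
      then show ?thesis using 2 zA by (simp add: span_zero)
    qed
  qed
qed

text \<open>In coordinates, the Leibniz identities for the triples \<open>x x y\<close>,
  \<open>y y x\<close> and \<open>x y x\<close> become relations between the two products. A nonzero
  mixed coefficient \<open>q\<close> or \<open>r\<close> forces anticommutation. Otherwise
  \<open>x \<bullet> y\<close> is a multiple of \<open>x\<close> and \<open>y \<bullet> x\<close> of
  \<open>y\<close>, and the third relation makes one of them vanish.\<close>

lemma square_zero_pair_cases:
  assumes x: "(x \<bullet> x) = 0" and y: "(y \<bullet> y) = 0"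
    and xy: "x \<bullet> y \<in> span {x, y}" and yx: "y \<bullet> x \<in> span {x, y}"
  obtains (anti) "y \<bullet> x = - (x \<bullet> y)"
    | (left) c where "x \<bullet> y = c *s x" "y \<bullet> x = 0"
    | (right) c where "y \<bullet> x = c *s y" "x \<bullet> y = 0"
proof -
  obtain p q r s where e: "x \<bullet> y = p *s x + q *s y" "y \<bullet> x = r *s x + s *s y"
    using xy yx by (auto simp: span_pair)
  have exp: "x \<bullet> (x \<bullet> y) = q *s (x \<bullet> y)" "(x \<bullet> y) \<bullet> x = q *s (y \<bullet> x)"
    "x \<bullet> (y \<bullet> x) = s *s (x \<bullet> y)" "y \<bullet> (y \<bullet> x) = r *s (y \<bullet> x)"
    "(y \<bullet> x) \<bullet> y = r *s (x \<bullet> y)" "y \<bullet> (x \<bullet> y) = p *s (y \<bullet> x)"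
    by (subst e(1) e(2); simp add: br_simps x y)+
  have 1: "q *s (x \<bullet> y) = - (q *s (y \<bullet> x))" using leibniz[of x x y] x exp by simp
  have 2: "r *s (y \<bullet> x) = - (r *s (x \<bullet> y))" using leibniz[of y y x] y exp by simp
  have 3: "s *s (x \<bullet> y) = q *s (y \<bullet> x)" using leibniz[of x y x] x exp by simp
  consider "q \<noteq> 0" | "r \<noteq> 0" | "q = 0" "r = 0" "s = 0" | "q = 0" "r = 0" "s \<noteq> 0" by blast
  then show thesis
  proof cases
    case 1
    then have "x \<bullet> y = - (y \<bullet> x)"
      using \<open>q *s (x \<bullet> y) = - (q *s (y \<bullet> x))\<close> scale_left_imp_eq[of q "x \<bullet> y" "- (y \<bullet> x)"] by simp
    then show thesis by (intro anti) simp
  next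
    case 2
    then have "y \<bullet> x = - (x \<bullet> y)"
      using \<open>r *s (y \<bullet> x) = - (r *s (x \<bullet> y))\<close> scale_left_imp_eq[of r "y \<bullet> x" "- (x \<bullet> y)"] by simp
    then show thesis by (rule anti)
  next
    case 3
    then show thesis using e by (intro left[of p]) auto
  next
    case 4
    then show thesis using e 3 by (intro right[of s]) auto
  qed
qed

text \<open>Closure of pairs extends bilinearly to the span, so no further products have to be
  added.\<close>

lemma generated_square_zero:
  assumes closed: "\<And>x y. (x \<bullet> x) = 0 \<Longrightarrow> (y \<bullet> y) = 0 \<Longrightarrow> x \<bullet> y \<in> span {x, y}"
  shows "generated {x. (x \<bullet> x) = 0} = span {x. (x \<bullet> x) = 0}"
proof
  let ?S = "{x. (x \<bullet> x) = 0}"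
  have "x \<bullet> y \<in> span ?S" if x: "x \<in> span ?S" and y: "y \<in> span ?S" for x y
    using x
  proof (induction rule: span_induct)
    case (step x)
    show ?case using y
    proof (induction rule: span_induct)
      case (step y)
      then have "span {x, y} \<subseteq> span ?S" using \<open>x \<in> ?S\<close> by (intro span_mono) auto
      then show ?case using closed step \<open>x \<in> ?S\<close> by auto
    qed (auto simp: subspace_def br_simps span_zero span_add span_scale)
  qed (auto simp: subspace_def br_simps span_zero span_add span_scale)
  then have "subalgebra (span ?S)" by (auto simp: subalgebra_def)
  then show "generated ?S \<subseteq> span ?S" by (intro generated_minimal span_superset)
  show "span ?S \<subseteq> generated ?S"
    using subalgebra_generated by (intro span_minimal generated_superset) (auto simp: subalgebra_def)
qed

section \<open>The Lie case\<close>

text \<open>A nonzero product yields some \<open>y\<close> with \<open>a \<bullet> y = a\<close>.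
  Right multiplication by \<open>y\<close> is then the identity modulo the line of \<open>y\<close>,
  and its fixed vectors form the abelian ideal.\<close>

lemma alternating_abelian_or_almost_abelian:
  assumes J: "subalgebra J" and alt: "\<And>x. x \<in> J \<Longrightarrow> (x \<bullet> x) = 0"
    and closed: "\<And>x y. x \<in> J \<Longrightarrow> y \<in> J \<Longrightarrow> x \<bullet> y \<in> span {x, y}"
  shows "abelian J \<or> almost_abelian_Lie J"
proof (cases "abelian J")
  case False
  have sJ: "subspace J" using J by (simp add: subalgebra_def)
  have anti: "y \<bullet> x = - (x \<bullet> y)" if "x \<in> J" "y \<in> J" for x y
    using alt[OF subspace_add[OF sJ that]] that alt
    by (simp add: br_simps eq_neg_iff_add_eq_0 add.commute)
  obtain u v where uv: "u \<in> J" "v \<in> J" "u \<bullet> v \<noteq> 0"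
    using False J by (auto simp: abelian_def)
  define a where "a = u \<bullet> v"
  have a: "a \<in> J" "a \<noteq> 0" using uv J by (auto simp: a_def subalgebra_def)
  obtain p q where pq: "a = p *s u + q *s v"
    using closed[OF uv(1,2)] by (auto simp: a_def span_pair)
  \<comment> \<open>Multiplying \<open>a = p *s u + q *s v\<close> on the right by \<open>v\<close>
    gives \<open>p *s a\<close>; if \<open>p = 0\<close>, multiplying by \<open>u\<close> gives
    \<open>- (q *s a)\<close>. Rescaling the factor makes the eigenvalue one.\<close>
  obtain y where y: "y \<in> J" "a \<bullet> y = a"
  proof (cases "p = 0")
    case False
    have "a \<bullet> v = p *s a" using alt uv by (subst pq) (simp add: br_simps a_def)
    then show thesis using False uv subspace_scale[OF sJ]
      by (intro that[of "inverse p *s v"]) (auto simp: br_simps)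
  next
    case True
    then have "q \<noteq> 0" using a pq by auto
    have "a \<bullet> u = - (q *s a)"
      using alt uv anti[of u v] True by (subst pq) (simp add: br_simps a_def)
    then show thesis using \<open>q \<noteq> 0\<close> uv subspace_scale[OF sJ]
subspace_neg[OF sJ]
      by (intro that[of "- (inverse q *s u)"]) (auto simp: br_simps br_minus)
  qed
  \<comment> \<open>Outside \<open>span {a, y}\<close>, computing \<open>(a + w) \<bullet> y\<close>
    in two ways forces the eigenvalue on \<open>w\<close> to agree with the eigenvalue one on
    \<open>a\<close>.\<close>
  have key: "\<exists>c. w \<bullet> y = w + c *s y" if w: "w \<in> J" for w
  proof (cases "w \<in> span {a, y}")
    case True
    then obtain c d where "w = c *s a + d *s y" by (auto simp: span_pair)
    then have "w \<bullet> y = w + (- d) *s y" using y alt by (simp add: br_simps)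
    then show ?thesis by blast
  next
    case False
    obtain r s where rs: "w \<bullet> y = r *s w + s *s y"
      using closed[OF w y(1)] by (auto simp: span_pair)
    obtain c d where "(a + w) \<bullet> y = c *s (a + w) + d *s y"
      using closed[OF subspace_add[OF sJ a(1) w] y(1)] by (auto simp: span_pair)
    then have cd: "a + (r *s w + s *s y) = c *s (a + w) + d *s y"
      using rs y by (simp add: br_simps)
    then have "(r - c) *s w = (c - 1) *s a + (d - s) *s y"
      by (simp add: algebra_simps)
    then have "(r - c) *s w \<in> span {a, y}" unfolding span_pair by blast
    then have rc: "r = c"
      using False scale_mem_subspace_cancel[OF subspace_span, of "r - c" w] by auto
    have "r = 1"
    proof (rule ccontr)
      assume "r \<noteq> 1"
      have e: "(1 - r) *s a = (d - s) *s y"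
        using cd rc by (simp add: algebra_simps)
      have "(1 - r) *s (a \<bullet> y) = 0"
        using arg_cong[OF e, of "\<lambda>t. t \<bullet> y"] alt y(1) by (simp only: br_simps) simp
      then show False using y a \<open>r \<noteq> 1\<close> by simp
    qed
    then show ?thesis using rs by auto
  qed
  define A where "A = {w \<in> J. w \<bullet> y = w}"
  have sA: "subspace A"
    using sJ by (auto simp: A_def subspace_def br_simps)
  have AJ: "A \<subseteq> J" by (auto simp: A_def)
  \<comment> \<open>Closedness keeps \<open>w \<bullet> w'\<close> in \<open>A\<close>, so all three
    terms of the Leibniz identity for \<open>w\<close>, \<open>w'\<close>, \<open>y\<close> equal
    \<open>w \<bullet> w'\<close>, which is therefore zero.\<close>
  have zA: "w \<bullet> w' = 0" if w: "w \<in> A" and w': "w' \<in> A" for w w'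
  proof -
    have "span {w, w'} \<subseteq> A" using w w' sA by (intro span_minimal) auto
    then have "w \<bullet> w' \<in> A" using closed w w' AJ by blast
    then have "(w \<bullet> w') \<bullet> y = w \<bullet> w'" by (simp add: A_def)
    moreover have "w \<bullet> (w' \<bullet> y) = w \<bullet> w'" "(w \<bullet> y) \<bullet> w' = w \<bullet> w'"
      using w w' by (auto simp: A_def)
    ultimately show ?thesis using leibniz[of w w' y] by simp
  qed
  have Jeq: "J = {a + c *s y | a c. a \<in> A}"
  proof (intro set_eqI iffI)
    fix w assume w: "w \<in> J"
    obtain c where c: "w \<bullet> y = w + c *s y" using key[OF w] by blast
    have "w + c *s y \<in> A"
      using w y c sJ alt by (auto simp: A_def br_simps subspace_add subspace_scale)
    moreover have "w = (w + c *s y) + (- c) *s y" by simp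
    ultimately show "w \<in> {a + c *s y | a c. a \<in> A}" by blast
  next
    fix w assume "w \<in> {a + c *s y | a c. a \<in> A}"
    then show "w \<in> J" using AJ y sJ by (auto intro!: subspace_add subspace_scale)
  qed
  have right: "w \<bullet> y = w" "y \<bullet> w = - w" if "w \<in> A" for w
    using that anti[of w y] y by (auto simp: A_def)
  have ideal: "ideal_of A J"
    unfolding ideal_of_def
  proof (intro conjI ballI)
    fix w m assume w: "w \<in> A" and "m \<in> J"
    then obtain b c where m: "m = b + c *s y" "b \<in> A" unfolding Jeq by blast
    then show "w \<bullet> m \<in> A"
      using w zA right subspace_scale[OF sA] by (simp add: br_simps)
    show "m \<bullet> w \<in> A"
      using m w zA right subspace_scale[OF sA] subspace_neg[OF sA] by (simp add: br_simps)
  qed (use sA AJ in auto)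
  have "abelian A" using sA zA subspace_0[OF sA] by (auto simp: abelian_def subalgebra_def)
  moreover have "A \<noteq> {0}" using a y by (auto simp: A_def)
  ultimately have "almost_abelian_split J A y"
    using J ideal Jeq right unfolding almost_abelian_split_def by blast
  then show ?thesis using right unfolding almost_abelian_Lie_def by blast
qed simp

section \<open>The non-Lie case\<close>

lemma span_square_zero_nonLie:
  assumes closed: "\<And>x y. (x \<bullet> x) = 0 \<Longrightarrow> (y \<bullet> y) = 0 \<Longrightarrow> x \<bullet> y \<in> span {x, y}"
    and J: "J = span {x. (x \<bullet> x) = 0}" "subalgebra J"
    and z: "z \<noteq> 0" "(z \<bullet> z) = 0" and y: "(y \<bullet> y) = 0"
    and zy: "z \<bullet> y = z" and yz: "y \<bullet> z = 0"
  shows "almost_abelian_nonLie J"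
proof -
  have sJ: "subspace J" using J by simp
  have in_J: "w \<in> J" if "(w \<bullet> w) = 0" for w using that J by (auto intro: span_base)
  \<comment> \<open>The square of \<open>z + y\<close> is \<open>z\<close>, and any element times a
    square is zero.\<close>
  have vz: "v \<bullet> z = 0" for v
    using br_square[of v "z + y"] z y zy yz by (simp add: br_simps)
  define A where "A = {w \<in> J. (\<forall>v. v \<bullet> w = 0) \<and> w \<bullet> y = w}"
  have sA: "subspace A"
    using sJ by (auto simp: A_def subspace_def br_simps)
  have A_right: "w \<in> A" if w: "(w \<bullet> w) = 0" and zw: "z \<bullet> w = 0" for w
  proof (cases "w \<in> span {z}")
    case True
    then show ?thesis using in_J[OF w] vz zy by (auto simp: A_def span_singleton br_simps)
  next
    case False
    have indep: "c = 0 \<and> d = 0" if "c *s z = d *s w" for c d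
    proof -
      have "d *s w \<in> span {z}" unfolding that[symmetric] by (simp add: span_base span_scale)
      then have "d = 0" using False scale_mem_subspace_cancel[OF subspace_span, of d w] by auto
      then show ?thesis using that z by auto
    qed
    \<comment> \<open>Both \<open>w\<close> and \<open>z + w\<close> now have square zero, so their
      products with \<open>y\<close> give two expressions each for \<open>y \<bullet> w\<close> and
      \<open>w \<bullet> y\<close>.\<close>
    have sq: "(z + w) \<bullet> (z + w) = 0" using w z vz zw by (simp add: br_simps)
    have "y \<bullet> w \<in> span {y, w}" using closed y w by blast
    then obtain p q where pq: "y \<bullet> w = p *s y + q *s w" by (auto simp: span_pair)
    have "w \<bullet> y \<in> span {w, y}" using closed y w by blast
    then obtain r s where rs: "w \<bullet> y = r *s w + s *s y" by (auto simp: span_pair)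
    have "y \<bullet> (z + w) \<in> span {y, z + w}" using closed y sq by blast
    then obtain p' q' where "y \<bullet> (z + w) = p' *s y + q' *s (z + w)" by (auto simp: span_pair)
    then have pq': "y \<bullet> w = p' *s y + q' *s (z + w)" using yz by (simp add: br_simps)
    have "(z + w) \<bullet> y \<in> span {z + w, y}" using closed y sq by blast
    then obtain r' s' where "(z + w) \<bullet> y = r' *s (z + w) + s' *s y" by (auto simp: span_pair)
    then have rs': "z + w \<bullet> y = r' *s (z + w) + s' *s y" using zy by (simp add: br_simps)
    \<comment> \<open>Left multiplication by \<open>z\<close> kills \<open>z\<close> and
      \<open>w\<close> but sends \<open>y\<close> to \<open>z\<close>, so it isolates the
      coefficients of \<open>y\<close> in these expressions.\<close>
    have zyw: "z \<bullet> (y \<bullet> w) = 0" "z \<bullet> (w \<bullet> y) = 0"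
      using leibniz[of z y w] leibniz[of z w y] zy zw by auto
    have "p *s z = 0" using zyw(1) zy zw unfolding pq by (simp add: br_simps)
    moreover have "p' *s z = 0" using zyw(1) zy zw z(2) unfolding pq' by (simp add: br_simps)
    moreover have "s *s z = 0" using zyw(2) zy zw unfolding rs by (simp add: br_simps)
    moreover have "z \<bullet> (z + w \<bullet> y) = s' *s z"
      unfolding rs' using zy zw z(2) by (simp add: br_simps)
    then have "s' *s z = 0" using zyw(2) z(2) by (simp add: br_simps)
    ultimately have 0: "p = 0" "p' = 0" "s = 0" "s' = 0" using z(1) by auto
    have "q' *s z = (q - q') *s w" using pq pq' 0 by (simp add: algebra_simps)
    then have "q = 0" using indep by fastforce
    then have yw: "y \<bullet> w = 0" using pq 0 by simp
    have "(1 - r') *s z = (r' - r) *s w" using rs rs' 0 by (simp add: algebra_simps)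
    then have "r = 1" using indep by fastforce
    then have wy: "w \<bullet> y = w" using rs 0 by simp
    \<comment> \<open>As for \<open>z\<close>: now \<open>w\<close> is the square of
      \<open>w + y\<close>.\<close>
    have "v \<bullet> w = 0" for v
      using br_square[of v "w + y"] w y wy yw by (simp add: br_simps)
    then show ?thesis using in_J[OF w] wy by (simp add: A_def)
  qed
  have S_sub: "\<exists>a c. w = a + c *s y \<and> a \<in> A" if w: "(w \<bullet> w) = 0" for w
  proof -
    have zw: "z \<bullet> w \<in> span {z, w}" "w \<bullet> z \<in> span {z, w}"
      using closed[OF z(2) w] vz by (auto simp: span_zero)
    obtain c where c: "z \<bullet> w = c *s z"
      using z(2) w zw
    proof (cases rule: square_zero_pair_cases)
      case anti
      then show thesis using vz[of w] by (intro that[of 0]) simp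
    next
      case (left c)
      then show thesis by (intro that)
    next
      case right
      then show thesis by (intro that[of 0]) simp
    qed
    show ?thesis
    proof (cases "c = 0")
      case True
      then have "w \<in> A" using w c by (intro A_right) auto
      moreover have "w = w + 0 *s y" by simp
      ultimately show ?thesis by blast
    next
      case False
      \<comment> \<open>The scaling gives \<open>z \<bullet> u = z \<bullet> y\<close>, so
        \<open>z\<close> annihilates \<open>u - y\<close> from the left; once its square is known to
        be zero, \<open>A_right\<close> applies to it.\<close>
      define u where "u = inverse c *s w"
      have u: "(u \<bullet> u) = 0" "z \<bullet> u = z" using False w c by (auto simp: u_def br_simps)
      have zz: "z \<bullet> (u \<bullet> y) = 0" "z \<bullet> (y \<bullet> u) = 0"
        using leibniz[of z u y] leibniz[of z y u] u zy by auto
      have uy: "u \<bullet> y \<in> span {u, y}" "y \<bullet> u \<in> span {u, y}"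
        using closed[OF u(1) y] closed[OF y u(1)] by (auto simp: insert_commute)
      \<comment> \<open>In a one-sided case the only nonzero candidate is a
        \<open>d\<close>-multiple of \<open>u\<close> or \<open>y\<close>; left multiplication by
        \<open>z\<close> turns it into \<open>d *s z\<close>, and \<open>zz\<close> gives
        \<open>d = 0\<close>.\<close>
      have "u \<bullet> y + y \<bullet> u = 0"
        using u(1) y uy
      proof (cases rule: square_zero_pair_cases)
        case (left d)
        then have "d *s z = 0" using zz u by (simp add: br_simps)
        then show ?thesis using left z by auto
      next
        case (right d)
        then have "d *s z = 0" using zz zy by (simp add: br_simps)
        then show ?thesis using right z by auto
      qed simp
      moreover have "(u - y) \<bullet> (u - y) = - (u \<bullet> y + y \<bullet> u)"
        using u y by (simp add: br_simps)
      ultimately have "(u - y) \<bullet> (u - y) = 0" by simp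
      then have "u - y \<in> A" using u zy by (intro A_right) (auto simp: br_simps)
      then have "c *s (u - y) \<in> A" by (rule subspace_scale[OF sA])
      moreover have "w = c *s (u - y) + c *s y"
        using False by (simp add: u_def scale_right_diff_distrib)
      ultimately show ?thesis by blast
    qed
  qed
  have Jeq: "J = {a + c *s y | a c. a \<in> A}"
  proof
    have "{a + c *s y | a c. a \<in> A} = {a + b | a b. a \<in> A \<and> b \<in> span {y}}"
      by (auto simp: span_singleton)
    then have "subspace {a + c *s y | a c. a \<in> A}"
      using subspace_sums[OF sA subspace_span[of "{y}"]] by simp
    then show "J \<subseteq> {a + c *s y | a c. a \<in> A}"
      unfolding J(1) using S_sub by (intro span_minimal) auto
    show "{a + c *s y | a c. a \<in> A} \<subseteq> J"
      using in_J[OF y] sJ by (auto simp: A_def intro!: subspace_add subspace_scale)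
  qed
  have A: "w \<bullet> y = w" "v \<bullet> w = 0" if "w \<in> A" for w v
    using that by (auto simp: A_def)
  have "ideal_of A J"
    unfolding ideal_of_def
  proof (intro conjI ballI)
    fix w m assume w: "w \<in> A" and "m \<in> J"
    then obtain b c where "m = b + c *s y" "b \<in> A" unfolding Jeq by blast
    then show "w \<bullet> m \<in> A" using w A subspace_scale[OF sA] by (simp add: br_simps)
    show "m \<bullet> w \<in> A" using w A subspace_0[OF sA] by simp
  qed (use sA in \<open>auto simp: A_def\<close>)
  moreover have "abelian A"
    using sA A subspace_0[OF sA] by (auto simp: abelian_def subalgebra_def)
  moreover have "z \<in> A" using z by (intro A_right) auto
  ultimately have "almost_abelian_split J A y"
    using J(2) Jeq A z(1) unfolding almost_abelian_split_def by blast
  then show ?thesis using A unfolding almost_abelian_nonLie_def by blast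
qed

section \<open>Combining the two cases\<close>

lemma span_square_zero_abelian_or_almost_abelian:
  assumes closed: "\<And>x y. (x \<bullet> x) = 0 \<Longrightarrow> (y \<bullet> y) = 0 \<Longrightarrow> x \<bullet> y \<in> span {x, y}"
  shows "abelian (generated {x. (x \<bullet> x) = 0}) \<or> almost_abelian (generated {x. (x \<bullet> x) = 0})"
proof -
  define J where "J = generated {x. (x \<bullet> x) = 0}"
  have J: "J = span {x. (x \<bullet> x) = 0}" "subalgebra J"
    unfolding J_def by (rule generated_square_zero[OF closed], assumption+, rule subalgebra_generated)
  have nonLie: "almost_abelian J"
    if "(x \<bullet> x) = 0" "(y \<bullet> y) = 0" "x \<bullet> y = c *s x" "y \<bullet> x = 0" "x \<bullet> y \<noteq> 0" for x y c
  proof -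
    have "x \<noteq> 0" "c \<noteq> 0" using that by auto
    then have "almost_abelian_nonLie J"
      \<comment> \<open>Dividing \<open>y\<close> by \<open>c\<close> normalises
        \<open>x \<bullet> y = c *s x\<close> to eigenvalue one.\<close>
      using that by (intro span_square_zero_nonLie[OF closed J, of x "inverse c *s y"])
        (auto simp: br_simps)
    then show ?thesis by (simp add: almost_abelian_def)
  qed
  show ?thesis unfolding J_def[symmetric]
  proof (cases "\<forall>x y. (x \<bullet> x) = 0 \<longrightarrow> (y \<bullet> y) = 0 \<longrightarrow> y \<bullet> x = - (x \<bullet> y)")
    case True
    \<comment> \<open>Anticommutation makes the square-zero elements closed under sums; they form a
      subspace, so every element of \<open>J\<close> has square zero.\<close>
    have "(x + y) \<bullet> (x + y) = 0" if "(x \<bullet> x) = 0" "(y \<bullet> y) = 0" for x y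
    proof -
      have "y \<bullet> x = - (x \<bullet> y)" using True that by blast
      then show ?thesis using that by (simp add: br_simps)
    qed
    then have "subspace {x. (x \<bullet> x) = 0}" by (auto simp: subspace_def br_simps(5,6))
    then have "J = {x. (x \<bullet> x) = 0}" using J(1) by (simp add: span_eq_iff)
    then have "abelian J \<or> almost_abelian_Lie J"
      using J(2) closed by (intro alternating_abelian_or_almost_abelian) auto
    then show "abelian J \<or> almost_abelian J" by (auto simp: almost_abelian_def)
  next
    case False
    then obtain x y where xy: "(x \<bullet> x) = 0" "(y \<bullet> y) = 0" "y \<bullet> x \<noteq> - (x \<bullet> y)" by blast
    have "x \<bullet> y \<in> span {x, y}" "y \<bullet> x \<in> span {x, y}"
      using closed[of x y] closed[of y x] xy by (auto simp: insert_commute)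
    with xy(1,2) have "almost_abelian J"
    proof (cases rule: square_zero_pair_cases)
      case anti
      then show ?thesis using xy(3) by simp
    next
      case (left c)
      then show ?thesis using nonLie[of x y c] xy by force
    next
      case (right c)
      then show ?thesis using nonLie[of y x c] xy by force
    qed
    then show "abelian J \<or> almost_abelian J" ..
  qed
qed

end

theorem theorem2p6:
  fixes scale :: "'f::field \<Rightarrow> 'v::ab_group_add \<Rightarrow> 'v"
    and br :: "'v \<Rightarrow> 'v \<Rightarrow> 'v"
    and J :: "'v set"
  assumes "leibniz_algebra scale br"
    and "leibniz_algebra.finite_dim scale"
    and "leibniz_algebra.solvable scale br"
    and "leibniz_algebra.upper_semimodular scale br"
    and "J = leibniz_algebra.generated scale br {x. br x x = 0}"
  shows "leibniz_algebra.abelian scale br J \<or> leibniz_algebra.almost_abelian scale br J"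
proof -
  interpret leibniz_algebra scale br by fact
  show ?thesis unfolding assms(5)
    using assms(3,4)
    by (intro span_square_zero_abelian_or_almost_abelian square_zero_pair_closed)
qed

end
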